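(* Let $k$ be a field, and let $A$ and $B$ be DG-algebras with $H_0(A)\cong k$ and $H_0(B)\cong k$. Let $\phi : A \to B$ be a morphism of DG-algebras such that the induced map on cycles $Z_\bullet(A)\to Z_\bullet(B)$ is surjective and the induced map on homology $\phi_* : H_\bullet(A)\to H_\bullet(B)$ is injective. Let $\mathcal{B}^A$ be a $k$-basis of $H_{\geq 1}(A)$ and let $\mathcal{B}^B$ be a $k$-basis of $H_{\geq 1}(B)$ such that $\phi_*(\mathcal{B}^A)\subset \mathcal{B}^B$, and assume that there exists a trivial Massey operation $\mu$ on $B$ with respect to $\mathcal{B}^B$. Then there exists a trivial Massey operation $\mu'$ on $A$ with respect to $\mathcal{B}^A$ such that $$\phi\big(\mu'(h_{\lambda_1},\dots,h_{\lambda_p})\big)=\mu\big(\phi_*(h_{\lambda_1}),\dots,\phi_*(h_{\lambda_p})\big)$$ for all $p\geq 1$ and all $h_{\lambda_1},\dots,h_{\lambda_p}\in\mathcal{B}^A$.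
   Context: A DG-algebra $(A,d)$ over a commutative Noetherian ring $R$ is a complex of finitely generated free $R$-modules (concentrated in non-negative homological degrees) with a unitary, associative multiplication $A\otimes_R A\to A$ satisfying $A_iA_j\subseteq A_{i+j}$; $d(f_if_j)=d(f_i)f_j+(-1)^i f_i d(f_j)$; $f_if_j=(-1)^{ij}f_jf_i$; and $f_i^2=0$ if $i$ is odd, where $f_\ell\in A_\ell$. Morphisms of DG-algebras are degree-preserving unital ring homomorphisms commuting with the differentials; the base rings of $A$ and $B$ may differ, and homology is regarded as a $k$-vector space compatibly, so that the induced maps on homology are $k$-linear. $Z_\bullet$ denotes cycles. For a homogeneous element $a$ of homological degree $|a|$, put $\overline{a}:=(-1)^{|a|+1}a$. Let $A$ be a DG-algebra with $H_0(A)\cong k$ and let $\mathcal{B}=\{h_\lambda\}_{\lambda\in\Lambda}$ be a $k$-basis of $H_{\geq 1}(A)$ consisting of homogeneous elements. A trivial Massey operation on $A$ with respect to $\mathcal{B}$ is a function $\mu:\coprod_{i=1}^\infty \mathcal{B}^i\to A$ with homogeneous values ($\mu(h_{\lambda_1},\dots,h_{\lambda_p})$ has degree $|h_{\lambda_1}|+\cdots+|h_{\lambda_p}|+p-1$) such that $\mu(h_\lambda)=z_\lambda$ is a cycle whose homology class is $h_\lambda$, and $$d\mu(h_{\lambda_1},\dots,h_{\lambda_p})=\sum_{j=1}^{p-1}\overline{\mu(h_{\lambda_1},\dots,h_{\lambda_j})}\,\mu(h_{\lambda_{j+1}},\dots,h_{\lambda_p}).$$ *)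

theory Defs
  imports
    "HOL-Algebra.Ring_Divisibility"
    "HOL-Algebra.QuotRing"
    "Jordan_Normal_Form.Missing_VectorSpace"
begin

section \<open>DG-algebras\<close>

text \<open>
  A free basis of a module over an arbitrary commutative ring, phrased with the same notions
  of linear dependence and span as \<^const>\<open>vectorspace.basis\<close>, which is restricted to fields.
\<close>

definition module_basis :: "('r, 'm) ring_scheme \<Rightarrow> ('r, 'a, 'z) module_scheme \<Rightarrow> 'a set \<Rightarrow> bool"
  where "module_basis R M S \<longleftrightarrow>
    S \<subseteq> carrier M \<and> \<not> module.lin_dep R M S \<and> module.span R M S = carrier M"

text \<open>
  A graded module is represented internally: the ring and module structure is that of the total
  object \<open>A = (\<Oplus>i. A_i)\<close>, and \<open>hpart A i\<close> is the set \<open>A_i\<close> of homogeneous elements of degree \<open>i\<close>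
  (zero belongs to every degree).
\<close>

record ('r, 'a) dga = "('r, 'a) module" +
  hpart :: "nat \<Rightarrow> 'a set"
  diff :: "'a \<Rightarrow> 'a"

locale dg_algebra = R: noetherian_ring R + module R A + A: ring A
  for R :: "('r, 'm) ring_scheme" (structure) and A :: "('r, 'a) dga" (structure) +
  assumes smult_mult_left:
      "\<lbrakk>r \<in> carrier R; x \<in> carrier A; y \<in> carrier A\<rbrakk>
        \<Longrightarrow> r \<odot>\<^bsub>A\<^esub> (x \<otimes>\<^bsub>A\<^esub> y) = (r \<odot>\<^bsub>A\<^esub> x) \<otimes>\<^bsub>A\<^esub> y"
    and smult_mult_right:
      "\<lbrakk>r \<in> carrier R; x \<in> carrier A; y \<in> carrier A\<rbrakk>
        \<Longrightarrow> r \<odot>\<^bsub>A\<^esub> (x \<otimes>\<^bsub>A\<^esub> y) = x \<otimes>\<^bsub>A\<^esub> (r \<odot>\<^bsub>A\<^esub> y)"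
    and hpart_submodule: "Module.submodule (hpart A i) R A"
    and hpart_direct_sum:
      "x \<in> carrier A \<Longrightarrow>
        \<exists>!f. (\<forall>i. f i \<in> hpart A i) \<and> finite {i. f i \<noteq> \<zero>\<^bsub>A\<^esub>} \<and>
             x = (\<Oplus>\<^bsub>A\<^esub>i\<in>{i. f i \<noteq> \<zero>\<^bsub>A\<^esub>}. f i)"
    and hpart_free: "\<exists>S. finite S \<and> module_basis R (A\<lparr>carrier := hpart A i\<rparr>) S"
    and one_hpart: "\<one>\<^bsub>A\<^esub> \<in> hpart A 0"
    and mult_hpart: "\<lbrakk>x \<in> hpart A i; y \<in> hpart A j\<rbrakk> \<Longrightarrow> x \<otimes>\<^bsub>A\<^esub> y \<in> hpart A (i + j)"
    and diff_linear: "diff A \<in> module_hom R A A"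
    and diff_hpart_Suc: "x \<in> hpart A (Suc i) \<Longrightarrow> diff A x \<in> hpart A i"
    and diff_hpart_0: "x \<in> hpart A 0 \<Longrightarrow> diff A x = \<zero>\<^bsub>A\<^esub>"
    and diff_diff: "x \<in> carrier A \<Longrightarrow> diff A (diff A x) = \<zero>\<^bsub>A\<^esub>"
    and leibniz:
      "\<lbrakk>x \<in> hpart A i; y \<in> hpart A j\<rbrakk> \<Longrightarrow>
        diff A (x \<otimes>\<^bsub>A\<^esub> y) =
          diff A x \<otimes>\<^bsub>A\<^esub> y \<oplus>\<^bsub>A\<^esub> [((- 1 :: int) ^ i)] \<cdot>\<^bsub>A\<^esub> (x \<otimes>\<^bsub>A\<^esub> diff A y)"
    and graded_comm:
      "\<lbrakk>x \<in> hpart A i; y \<in> hpart A j\<rbrakk> \<Longrightarrow>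
        x \<otimes>\<^bsub>A\<^esub> y = [((- 1 :: int) ^ (i * j))] \<cdot>\<^bsub>A\<^esub> (y \<otimes>\<^bsub>A\<^esub> x)"
    and odd_square: "\<lbrakk>x \<in> hpart A i; odd i\<rbrakk> \<Longrightarrow> x \<otimes>\<^bsub>A\<^esub> x = \<zero>\<^bsub>A\<^esub>"

text \<open>The base rings of source and target may differ, so morphisms are only required to be
  ring homomorphisms.\<close>

definition dga_hom :: "('r, 'a) dga \<Rightarrow> ('s, 'b) dga \<Rightarrow> ('a \<Rightarrow> 'b) set"
  where "dga_hom A B = {\<phi> \<in> ring_hom A B.
    (\<forall>i. \<phi> ` hpart A i \<subseteq> hpart B i) \<and>
    (\<forall>x\<in>carrier A. \<phi> (diff A x) = diff B (\<phi> x))}"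


section \<open>Homology\<close>

definition cycles :: "('r, 'a) dga \<Rightarrow> 'a set"
  where "cycles A = {z \<in> carrier A. diff A z = \<zero>\<^bsub>A\<^esub>}"

definition boundaries :: "('r, 'a) dga \<Rightarrow> 'a set"
  where "boundaries A = diff A ` carrier A"

text \<open>The total homology ring: the quotient of the subring of cycles by the ideal of boundaries.\<close>

definition homology :: "('r, 'a) dga \<Rightarrow> 'a set ring"
  where "homology A = (A\<lparr>carrier := cycles A\<rparr>) Quot (boundaries A)"

definition hclass :: "('r, 'a) dga \<Rightarrow> 'a \<Rightarrow> 'a set"
  where "hclass A z = boundaries A +>\<^bsub>A\<^esub> z"

text \<open>The summand \<open>H_i(A)\<close> of the total homology.\<close>

definition homology_part :: "('r, 'a) dga \<Rightarrow> nat \<Rightarrow> 'a set set"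
  where "homology_part A i = hclass A ` (cycles A \<inter> hpart A i)"

definition homology_0 :: "('r, 'a) dga \<Rightarrow> 'a set ring"
  where "homology_0 A = (homology A)\<lparr>carrier := homology_part A 0\<rparr>"

text \<open>The degree of a class; it is determined only for nonzero homogeneous classes.\<close>

definition hdegree :: "('r, 'a) dga \<Rightarrow> 'a set \<Rightarrow> nat"
  where "hdegree A h = (THE i. h \<in> homology_part A i)"

text \<open>The underlying set of the direct sum of all \<open>H_i(A)\<close> with \<open>i \<ge> 1\<close>.\<close>

definition pos_homology :: "('r, 'a) dga \<Rightarrow> 'a set set"
  where "pos_homology A =
    {(\<Oplus>\<^bsub>homology A\<^esub>i\<in>{1..n}. h i) | n h. h \<in> (\<Pi> i\<in>{1..n}. homology_part A i)}"

text \<open>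
  An isomorphism \<open>\<iota>\<close> from the field \<open>k\<close> to \<open>H_0(A)\<close> makes the \<open>H_0(A)\<close>-module \<open>H(A)\<close> a
  \<open>k\<close>-vector space. (The fields \<^const>\<open>mult\<close> and \<^const>\<open>one\<close> are irrelevant for the module structure.)
\<close>

definition homology_space :: "('k \<Rightarrow> 'a set) \<Rightarrow> ('r, 'a) dga \<Rightarrow> ('k, 'a set) module"
  where "homology_space \<iota> A =
    \<lparr>carrier = carrier (homology A), mult = mult (homology A), one = one (homology A),
     zero = zero (homology A), add = add (homology A),
     smult = (\<lambda>c h. \<iota> c \<otimes>\<^bsub>homology A\<^esub> h)\<rparr>"

definition pos_homology_space :: "('k \<Rightarrow> 'a set) \<Rightarrow> ('r, 'a) dga \<Rightarrow> ('k, 'a set) module"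
  where "pos_homology_space \<iota> A = (homology_space \<iota> A)\<lparr>carrier := pos_homology A\<rparr>"

definition homogeneous_basis ::
  "('k, 'm) ring_scheme \<Rightarrow> ('k \<Rightarrow> 'a set) \<Rightarrow> ('r, 'a) dga \<Rightarrow> 'a set set \<Rightarrow> bool"
  where "homogeneous_basis K \<iota> A \<B> \<longleftrightarrow>
    vectorspace.basis K (pos_homology_space \<iota> A) \<B> \<and> \<B> \<subseteq> (\<Union>i\<in>{1..}. homology_part A i)"

text \<open>The map \<open>[z] \<mapsto> [\<phi> z]\<close>: the classes \<open>[\<phi> z]\<close> coincide for all \<open>z\<close> in a homology class \<open>h\<close>,
  so their union is the image of \<open>h\<close>.\<close>

definition homology_map :: "('r, 'a) dga \<Rightarrow> ('s, 'b) dga \<Rightarrow> ('a \<Rightarrow> 'b) \<Rightarrow> 'a set \<Rightarrow> 'b set"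
  where "homology_map A B \<phi> h = (\<Union>z\<in>h. hclass B (\<phi> z))"


section \<open>Trivial Massey operations\<close>

text \<open>The element \<open>(-1)^(i+1) a\<close> for a homogeneous element \<open>a\<close> of degree \<open>i\<close>; the degree is passed
  explicitly, as it is not determined by \<open>a\<close> when \<open>a = 0\<close>.\<close>

definition bar :: "('r, 'a) dga \<Rightarrow> nat \<Rightarrow> 'a \<Rightarrow> 'a"
  where "bar A i a = [((- 1 :: int) ^ (i + 1))] \<cdot>\<^bsub>A\<^esub> a"

definition massey_degree :: "('r, 'a) dga \<Rightarrow> 'a set list \<Rightarrow> nat"
  where "massey_degree A hs = sum_list (map (hdegree A) hs) + length hs - 1"

text \<open>The tuples in the coproduct of the \<open>\<B>^p\<close>, \<open>p \<ge> 1\<close>, are the nonempty lists over \<open>\<B>\<close>.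
  Values of \<open>\<mu>\<close> at other lists are irrelevant.\<close>

definition trivial_massey_operation ::
  "('r, 'a) dga \<Rightarrow> 'a set set \<Rightarrow> ('a set list \<Rightarrow> 'a) \<Rightarrow> bool"
  where "trivial_massey_operation A \<B> \<mu> \<longleftrightarrow>
    (\<forall>hs\<in>lists \<B>. hs \<noteq> [] \<longrightarrow> \<mu> hs \<in> hpart A (massey_degree A hs)) \<and>
    (\<forall>h\<in>\<B>. \<mu> [h] \<in> cycles A \<and> hclass A (\<mu> [h]) = h) \<and>
    (\<forall>hs\<in>lists \<B>. hs \<noteq> [] \<longrightarrow>
       diff A (\<mu> hs) =
         (\<Oplus>\<^bsub>A\<^esub>j\<in>{1..<length hs}.
            bar A (massey_degree A (take j hs)) (\<mu> (take j hs)) \<otimes>\<^bsub>A\<^esub> \<mu> (drop j hs)))"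

end

theory Submission
  imports Defs
begin

text \<open>
  The operation on \<open>A\<close> is built by recursion on the length of the tuple. Suppose that \<open>\<mu>'\<close> is
  known on all shorter tuples, satisfies its differential equation there and lies over \<open>\<mu>\<close>. The
  right-hand side \<open>w\<close> of the equation at the new tuple \<open>hs\<close> is then determined. Three facts produce
  a value \<open>x\<close> with \<open>d x = w\<close> and \<open>\<phi> x = b\<close>, where \<open>b\<close> is the value of \<open>\<mu>\<close> at the image of \<open>hs\<close>:

  \<^item> \<open>w\<close> is a cycle, by the Leibniz rule and the equations for the shorter tuples
    (\<open>massey_sum_cycle\<close>). This has to be computed in \<open>A\<close>: it cannot be inferred from \<open>B\<close>, as \<open>\<phi>\<close>
    may have a kernel.
  \<^item> \<open>\<phi> w = d b\<close> is a boundary, so \<open>w\<close> is a boundary \<open>d a\<close> because \<open>\<phi>\<close> is injective on homology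
    (\<open>reflect_boundary\<close>).
  \<^item> \<open>\<phi> a\<close> and \<open>b\<close> have the same differential, so \<open>\<phi> a - b\<close> is a cycle and equals \<open>\<phi> c\<close> for a
    cycle \<open>c\<close> of \<open>A\<close>. Take \<open>x = a - c\<close> (\<open>lift_primitive\<close>).

  A tuple of length one is handled by lifting the cycle \<open>\<mu> [\<phi>\<^sub>* h]\<close> to a cycle of \<open>A\<close>; it
  represents \<open>h\<close>, again by injectivity on homology.

  Degrees need care, since \<open>\<mu>'\<close> must have homogeneous values while the assumptions only yield
  arbitrary elements. The lifts are made homogeneous by passing to a component, which is compatible
  with \<open>d\<close> and \<open>\<phi>\<close> by uniqueness of the decomposition. The prescribed degrees on the two sides agree
  because \<open>\<phi>\<^sub>*\<close> preserves and reflects membership in each \<open>H\<^sub>i\<close> (\<open>hdegree_homology_map\<close>).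
\<close>

section \<open>Finite sums in abelian groups\<close>

lemma (in abelian_monoid) finsum_swap:
  assumes "finite I" "finite J" "\<And>i j. i \<in> I \<Longrightarrow> j \<in> J \<Longrightarrow> f i j \<in> carrier G"
  shows "(\<Oplus>i\<in>I. \<Oplus>j\<in>J. f i j) = (\<Oplus>j\<in>J. \<Oplus>i\<in>I. f i j)"
  using assms(1,3)
proof (induction I)
  case empty
  then show ?case by simp
next
  case (insert k I)
  have "(\<Oplus>i\<in>insert k I. \<Oplus>j\<in>J. f i j) = (\<Oplus>j\<in>J. f k j) \<oplus> (\<Oplus>i\<in>I. \<Oplus>j\<in>J. f i j)"
    by (rule finsum_insert) (use insert in \<open>auto intro!: finsum_closed\<close>)
  also have "\<dots> = (\<Oplus>j\<in>J. f k j \<oplus> (\<Oplus>i\<in>I. f i j))"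
    using insert by (subst finsum_addf) (auto intro!: finsum_closed)
  also have "\<dots> = (\<Oplus>j\<in>J. \<Oplus>i\<in>insert k I. f i j)"
    by (rule finsum_cong', rule refl)
      (use insert in \<open>auto intro!: finsum_closed finsum_insert[symmetric]\<close>)
  finally show ?case .
qed

lemma (in abelian_monoid) finsum_triangle_swap:
  fixes f :: "nat \<Rightarrow> nat \<Rightarrow> 'a"
  assumes "\<And>i j. i \<in> {a<..<b} \<Longrightarrow> j \<in> {a<..<b} \<Longrightarrow> i < j \<Longrightarrow> f i j \<in> carrier G"
  shows "(\<Oplus>j\<in>{a<..<b}. \<Oplus>i\<in>{a<..<j}. f i j) = (\<Oplus>i\<in>{a<..<b}. \<Oplus>j\<in>{i<..<b}. f i j)"
proof -
  \<comment> \<open>Extending by zero to the square turns both triangular sums into rectangular ones.\<close>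
  let ?g = "\<lambda>i j. if i < j then f i j else \<zero>"
  have "(\<Oplus>j\<in>{a<..<b}. \<Oplus>i\<in>{a<..<j}. f i j) = (\<Oplus>j\<in>{a<..<b}. \<Oplus>i\<in>{a<..<b}. ?g i j)"
    by (rule finsum_cong', rule refl)
      (use assms in \<open>auto intro!: finsum_closed add.finprod_mono_neutral_cong_left\<close>)
  also have "\<dots> = (\<Oplus>i\<in>{a<..<b}. \<Oplus>j\<in>{a<..<b}. ?g i j)"
    by (rule finsum_swap) (use assms in auto)
  also have "\<dots> = (\<Oplus>i\<in>{a<..<b}. \<Oplus>j\<in>{i<..<b}. f i j)"
    by (rule finsum_cong', rule refl)
      (use assms in \<open>auto intro!: finsum_closed add.finprod_mono_neutral_cong_right\<close>)
  finally show ?thesis .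
qed

lemma (in abelian_group) finsum_diff:
  assumes "f \<in> I \<rightarrow> carrier G" "g \<in> I \<rightarrow> carrier G"
  shows "(\<Oplus>i\<in>I. f i \<ominus> g i) = finsum G f I \<ominus> finsum G g I"
proof -
  have "(\<Oplus>i\<in>I. f i \<ominus> g i) \<oplus> finsum G g I = (\<Oplus>i\<in>I. (f i \<ominus> g i) \<oplus> g i)"
    using assms by (intro finsum_addf[symmetric]) auto
  also have "\<dots> = finsum G f I"
    using assms
    by (intro finsum_cong') (simp_all add: Pi_iff minus_eq a_assoc l_neg)
  finally show ?thesis
    using add.inv_solve_right[of "\<Oplus>i\<in>I. f i \<ominus> g i" "finsum G f I" "finsum G g I"] assms
    by (simp add: minus_eq Pi_iff finsum_closed)
qed

lemma (in abelian_group_hom) hom_finsum: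
  assumes "f \<in> I \<rightarrow> carrier G"
  shows "h (finsum G f I) = finsum H (\<lambda>i. h (f i)) I"
  using assms
proof (induction I rule: infinite_finite_induct)
  case (insert i I)
  then have "h (finsum G f (insert i I)) = h (f i) \<oplus>\<^bsub>H\<^esub> h (finsum G f I)"
    by (simp add: Pi_iff)
  with insert show ?case
    by (subst H.finsum_insert) (auto simp: Pi_iff)
qed (simp_all add: G.finsum_infinite H.finsum_infinite)

section \<open>Homogeneous components\<close>

context dg_algebra
begin

lemma hpart_carrier: "x \<in> hpart A i \<Longrightarrow> x \<in> carrier A"
  and hpart_uminus: "x \<in> hpart A i \<Longrightarrow> \<ominus>\<^bsub>A\<^esub> x \<in> hpart A i"
  and hpart_add: "x \<in> hpart A i \<Longrightarrow> y \<in> hpart A i \<Longrightarrow> x \<oplus>\<^bsub>A\<^esub> y \<in> hpart A i"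
  using submoduleE[OF hpart_submodule] by auto

lemma hpart_zero: "\<zero>\<^bsub>A\<^esub> \<in> hpart A i"
  using subgroup.one_closed[OF submodule.axioms(1)[OF hpart_submodule[of i]]] by simp

lemma hpart_minus: "x \<in> hpart A i \<Longrightarrow> y \<in> hpart A i \<Longrightarrow> x \<ominus>\<^bsub>A\<^esub> y \<in> hpart A i"
  by (simp add: a_minus_def hpart_add hpart_uminus)

lemma hpart_finsum:
  assumes "\<And>j. j \<in> J \<Longrightarrow> f j \<in> hpart A i"
  shows "finsum A f J \<in> hpart A i"
  using assms
proof (induction J rule: infinite_finite_induct)
  case (insert j J)
  then have "finsum A f (insert j J) = f j \<oplus>\<^bsub>A\<^esub> finsum A f J"
    by (intro M.finsum_insert) (auto intro: hpart_carrier)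
  with insert show ?case by (simp add: hpart_add)
qed (simp_all add: M.finsum_infinite hpart_zero)

lemma diff_hom: "abelian_group_hom A A (diff A)"
  using diff_linear
  by (intro abelian_group_homI M.abelian_group_axioms)
     (auto simp: LinearCombinations.module_hom_def group_hom_def group_hom_axioms_def hom_def
       M.add.is_group)

lemma diff_closed [simp, intro]: "x \<in> carrier A \<Longrightarrow> diff A x \<in> carrier A"
  using diff_linear by (auto simp: LinearCombinations.module_hom_def)

lemma homogeneous_components_unique:
  assumes f: "\<And>i. f i \<in> hpart A i" and g: "\<And>i. g i \<in> hpart A i"
    and eq: "(\<Oplus>\<^bsub>A\<^esub>i\<in>{..N}. f i) = (\<Oplus>\<^bsub>A\<^esub>i\<in>{..N}. g i)" and "n \<le> N"
  shows "f n = g n"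
proof -
  \<comment> \<open>The uniqueness axiom compares functions on all degrees, so both families are first cut off
    above \<open>N\<close>.\<close>
  let ?cut = "\<lambda>u i. if i \<le> N then u i else \<zero>\<^bsub>A\<^esub>"
  define x where "x = (\<Oplus>\<^bsub>A\<^esub>i\<in>{..N}. f i)"
  define P where "P = (\<lambda>u. (\<forall>i. u i \<in> hpart A i) \<and> finite {i. u i \<noteq> \<zero>\<^bsub>A\<^esub>} \<and>
    x = (\<Oplus>\<^bsub>A\<^esub>i\<in>{i. u i \<noteq> \<zero>\<^bsub>A\<^esub>}. u i))"
  have P: "P (?cut u)" if u: "\<And>i. u i \<in> hpart A i" and x: "x = (\<Oplus>\<^bsub>A\<^esub>i\<in>{..N}. u i)" for u
  proof -
    have sub: "{i. ?cut u i \<noteq> \<zero>\<^bsub>A\<^esub>} \<subseteq> {..N}" by auto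
    have "(\<Oplus>\<^bsub>A\<^esub>i\<in>{i. ?cut u i \<noteq> \<zero>\<^bsub>A\<^esub>}. ?cut u i) = (\<Oplus>\<^bsub>A\<^esub>i\<in>{..N}. u i)"
      by (rule M.add.finprod_mono_neutral_cong_left[OF _ sub])
        (use u hpart_carrier in \<open>auto split: if_splits\<close>)
    with x u sub show ?thesis
      unfolding P_def by (auto simp: hpart_zero intro: finite_subset)
  qed
  have "x \<in> carrier A"
    unfolding x_def using f hpart_carrier by (intro M.finsum_closed) auto
  then have "\<exists>!u. P u" unfolding P_def by (rule hpart_direct_sum)
  moreover have "P (?cut f)" "P (?cut g)"
    using P[OF f] P[OF g] eq by (simp_all add: x_def)
  ultimately have "?cut f = ?cut g" by auto
  then show ?thesis using \<open>n \<le> N\<close> by (auto dest: fun_cong[of _ _ n])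
qed

text \<open>This is how the decomposition is used: a map that shifts degrees sends the components of \<open>x\<close> to
  homogeneous summands of its value, and if that value is homogeneous, then it is a single one of
  the summands.\<close>

lemma component_of_homogeneous_sum:
  assumes f: "\<And>i. f i \<in> hpart A i" and y: "(\<Oplus>\<^bsub>A\<^esub>i\<in>{..N}. f i) \<in> hpart A n" and "n \<le> N"
  shows "f n = (\<Oplus>\<^bsub>A\<^esub>i\<in>{..N}. f i)"
proof -
  let ?y = "\<Oplus>\<^bsub>A\<^esub>i\<in>{..N}. f i"
  have "(\<Oplus>\<^bsub>A\<^esub>i\<in>{..N}. if n = i then ?y else \<zero>\<^bsub>A\<^esub>) = ?y"
    using M.finsum_singleton[of n "{..N}" "\<lambda>_. ?y"] \<open>n \<le> N\<close> hpart_carrier[OF y] by auto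
  moreover have "(if n = i then ?y else \<zero>\<^bsub>A\<^esub>) \<in> hpart A i" for i
    using y by (auto simp: hpart_zero)
  ultimately show ?thesis
    using homogeneous_components_unique[of f "\<lambda>i. if n = i then ?y else \<zero>\<^bsub>A\<^esub>" N n] f \<open>n \<le> N\<close>
    by auto
qed

text \<open>The bound \<open>N\<close> may be taken beyond any degree \<open>n\<close> of interest, so that the component of
  degree \<open>n\<close> appears in the sum.\<close>

lemma homogeneous_decomposition:
  assumes "x \<in> carrier A"
  obtains f N where "\<And>i. f i \<in> hpart A i" "x = (\<Oplus>\<^bsub>A\<^esub>i\<in>{..N}. f i)" "n \<le> N"
proof -
  obtain f where f: "\<And>i. f i \<in> hpart A i" "finite {i. f i \<noteq> \<zero>\<^bsub>A\<^esub>}"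
    "x = (\<Oplus>\<^bsub>A\<^esub>i\<in>{i. f i \<noteq> \<zero>\<^bsub>A\<^esub>}. f i)"
    using hpart_direct_sum[OF assms] by auto
  obtain N0 where "{i. f i \<noteq> \<zero>\<^bsub>A\<^esub>} \<subseteq> {..N0}"
    using f(2) finite_nat_iff_bounded_le by auto
  then have sub: "{i. f i \<noteq> \<zero>\<^bsub>A\<^esub>} \<subseteq> {..max n N0}" by auto
  have "x = (\<Oplus>\<^bsub>A\<^esub>i\<in>{..max n N0}. f i)"
    unfolding f(3)
    by (rule M.add.finprod_mono_neutral_cong_left[OF _ sub]) (use f hpart_carrier in auto)
  with f(1) show thesis by (rule that) simp
qed

lemma diff_sum_components:
  assumes "\<And>i. f i \<in> hpart A i"
  shows "diff A (\<Oplus>\<^bsub>A\<^esub>i\<in>{..Suc N}. f i) = (\<Oplus>\<^bsub>A\<^esub>i\<in>{..N}. diff A (f (Suc i)))"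
proof -
  have f: "f i \<in> carrier A" for i using assms hpart_carrier by auto
  have "diff A (\<Oplus>\<^bsub>A\<^esub>i\<in>{..Suc N}. f i) = (\<Oplus>\<^bsub>A\<^esub>i\<in>{..Suc N}. diff A (f i))"
    using f by (intro abelian_group_hom.hom_finsum[OF diff_hom]) auto
  also have "\<dots> = (\<Oplus>\<^bsub>A\<^esub>i\<in>{..N}. diff A (f (Suc i))) \<oplus>\<^bsub>A\<^esub> diff A (f 0)"
    using f by (intro M.finsum_Suc2) auto
  also have "\<dots> = (\<Oplus>\<^bsub>A\<^esub>i\<in>{..N}. diff A (f (Suc i)))"
    using f by (simp add: diff_hpart_0[OF assms] M.finsum_closed)
  finally show ?thesis .
qed

lemma homogeneous_boundary:
  assumes "a \<in> carrier A" "diff A a \<in> hpart A m"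
  obtains a' where "a' \<in> hpart A (Suc m)" "diff A a' = diff A a"
proof -
  obtain f N where f: "\<And>i. f i \<in> hpart A i" "a = (\<Oplus>\<^bsub>A\<^esub>i\<in>{..N}. f i)" "Suc m \<le> N"
    using homogeneous_decomposition[OF assms(1)] by metis
  then obtain M where N: "N = Suc M" by (cases N) auto
  have "diff A (f (Suc m)) = diff A a"
    using component_of_homogeneous_sum[of "\<lambda>i. diff A (f (Suc i))" M m] f assms
    by (simp add: N diff_sum_components diff_hpart_Suc)
  with f(1) that show thesis by auto
qed

lemma component_of_cycle:
  assumes f: "\<And>i. f i \<in> hpart A i" and cycle: "diff A (\<Oplus>\<^bsub>A\<^esub>i\<in>{..N}. f i) = \<zero>\<^bsub>A\<^esub>" and "n \<le> N"
  shows "diff A (f n) = \<zero>\<^bsub>A\<^esub>"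
proof (cases n)
  case 0
  then show ?thesis using f diff_hpart_0 by metis
next
  case (Suc m)
  then obtain M where N: "N = Suc M" using \<open>n \<le> N\<close> by (cases N) auto
  show ?thesis
    using component_of_homogeneous_sum[of "\<lambda>i. diff A (f (Suc i))" M m] f cycle \<open>n \<le> N\<close>
    by (simp add: N Suc diff_sum_components diff_hpart_Suc hpart_zero)
qed


section \<open>The Massey sum is a cycle\<close>

lemma bar_eq: "x \<in> carrier A \<Longrightarrow> bar A i x = (if even i then \<ominus>\<^bsub>A\<^esub> x else x)"
  by (auto simp: bar_def add_pow_int_lt add_pow_int_ge)

lemma bar_hpart: "x \<in> hpart A i \<Longrightarrow> bar A j x \<in> hpart A i"
  by (simp add: bar_eq hpart_carrier hpart_uminus)

lemma bar_closed [simp, intro]: "x \<in> carrier A \<Longrightarrow> bar A j x \<in> carrier A"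
  by (simp add: bar_eq)

lemma diff_bar: "x \<in> carrier A \<Longrightarrow> diff A (bar A i x) = bar A i (diff A x)"
  by (simp add: bar_eq abelian_group_hom.hom_a_inv[OF diff_hom])

text \<open>The reason for the sign in \<^const>\<open>bar\<close>: the second term of the Leibniz rule gets the sign
  \<open>(-1)^i (-1)^(i+1) = -1\<close>, whatever the degree.\<close>

lemma leibniz_bar:
  assumes x: "x \<in> hpart A i" and y: "y \<in> hpart A j"
  shows "diff A (bar A i x \<otimes>\<^bsub>A\<^esub> y) = bar A i (diff A x) \<otimes>\<^bsub>A\<^esub> y \<ominus>\<^bsub>A\<^esub> x \<otimes>\<^bsub>A\<^esub> diff A y"
proof -
  note [simp] = hpart_carrier[OF x] hpart_carrier[OF y]
  have "diff A (bar A i x \<otimes>\<^bsub>A\<^esub> y) =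
      bar A i (diff A x) \<otimes>\<^bsub>A\<^esub> y \<oplus>\<^bsub>A\<^esub> [((- 1 :: int) ^ i)] \<cdot>\<^bsub>A\<^esub> (bar A i x \<otimes>\<^bsub>A\<^esub> diff A y)"
    by (simp add: leibniz[OF bar_hpart[OF x] y] diff_bar)
  also have "[((- 1 :: int) ^ i)] \<cdot>\<^bsub>A\<^esub> (bar A i x \<otimes>\<^bsub>A\<^esub> diff A y) = \<ominus>\<^bsub>A\<^esub> (x \<otimes>\<^bsub>A\<^esub> diff A y)"
    by (cases "even i") (auto simp: bar_eq add_pow_int_lt add_pow_int_ge A.l_minus)
  finally show ?thesis by (simp add: a_minus_def)
qed

text \<open>The degree \<open>Suc (i + j)\<close> is that of an element whose differential contains the product; its
  sign \<open>(-1)^(i+j)\<close> and the sign \<open>(-1)^(i+1)\<close> of \<open>x\<close> combine to \<open>(-1)^(j+1)\<close>.\<close>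

lemma bar_bar_mult:
  assumes "x \<in> carrier A" "y \<in> carrier A"
  shows "bar A (Suc (i + j)) (bar A i x \<otimes>\<^bsub>A\<^esub> y) = x \<otimes>\<^bsub>A\<^esub> bar A j y"
  using assms by (auto simp: bar_eq A.l_minus A.r_minus)

lemma bar_finsum:
  assumes "f \<in> I \<rightarrow> carrier A"
  shows "bar A i (finsum A f I) = (\<Oplus>\<^bsub>A\<^esub>j\<in>I. bar A i (f j))"
proof -
  have "abelian_group_hom A A (bar A i)"
    by (intro abelian_group_homI M.abelian_group_axioms)
      (auto simp: group_hom_def group_hom_axioms_def hom_def M.add.is_group bar_eq M.minus_add)
  then show ?thesis using assms by (rule abelian_group_hom.hom_finsum)
qed

text \<open>
  Here \<open>m i j\<close> stands for the value at the entries of a fixed tuple of length \<open>p\<close> with positions in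
  \<open>{i..<j}\<close>, and \<open>e i j\<close> for its degree. Applying \<open>d\<close> to the \<open>l\<close>-th summand gives, by
  \<open>leibniz_bar\<close>, the differential of the left factor minus that of the right factor. Both expand
  into the same triple products \<open>T i l\<close> that belong to the two cut points \<open>i < l\<close>: the left
  factors produce each one with the larger cut point as outer index, the right factors with the smaller
  one. Hence everything cancels. The interval \<open>(0, p)\<close> is excluded because its value is what the
  sum is meant to define.
\<close>

lemma massey_sum_cycle:
  fixes m :: "nat \<Rightarrow> nat \<Rightarrow> 'a" and e :: "nat \<Rightarrow> nat \<Rightarrow> nat"
  assumes deg: "\<And>i j. i < j \<Longrightarrow> j \<le> p \<Longrightarrow> (i, j) \<noteq> (0, p) \<Longrightarrow> m i j \<in> hpart A (e i j)"
    and e: "\<And>i l j. i < l \<Longrightarrow> l < j \<Longrightarrow> j \<le> p \<Longrightarrow> e i j = Suc (e i l + e l j)"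
    and d: "\<And>i j. i < j \<Longrightarrow> j \<le> p \<Longrightarrow> (i, j) \<noteq> (0, p) \<Longrightarrow>
      diff A (m i j) = (\<Oplus>\<^bsub>A\<^esub>l\<in>{i<..<j}. bar A (e i l) (m i l) \<otimes>\<^bsub>A\<^esub> m l j)"
  shows "diff A (\<Oplus>\<^bsub>A\<^esub>l\<in>{0<..<p}. bar A (e 0 l) (m 0 l) \<otimes>\<^bsub>A\<^esub> m l p) = \<zero>\<^bsub>A\<^esub>"
proof -
  note closed [intro] = hpart_carrier[OF deg]
  define T where "T = (\<lambda>i l. m 0 i \<otimes>\<^bsub>A\<^esub> bar A (e i l) (m i l) \<otimes>\<^bsub>A\<^esub> m l p)"
  have T [simp]: "T i l \<in> carrier A" if "0 < i" "i < l" "l < p" for i l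
    using that unfolding T_def by (intro A.m_closed bar_closed closed) auto
  have left: "bar A (e 0 l) (diff A (m 0 l)) \<otimes>\<^bsub>A\<^esub> m l p = (\<Oplus>\<^bsub>A\<^esub>i\<in>{0<..<l}. T i l)"
    if l: "l \<in> {0<..<p}" for l
  proof -
    have "bar A (e 0 l) (diff A (m 0 l)) =
        (\<Oplus>\<^bsub>A\<^esub>i\<in>{0<..<l}. bar A (e 0 l) (bar A (e 0 i) (m 0 i) \<otimes>\<^bsub>A\<^esub> m i l))"
      using l by (subst d) (auto intro!: bar_finsum A.m_closed bar_closed closed)
    also have "\<dots> = (\<Oplus>\<^bsub>A\<^esub>i\<in>{0<..<l}. m 0 i \<otimes>\<^bsub>A\<^esub> bar A (e i l) (m i l))"
    proof (rule M.finsum_cong', rule refl)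
      fix i assume i: "i \<in> {0<..<l}"
      then have "e 0 l = Suc (e 0 i + e i l)" using l by (intro e) auto
      with i l show "bar A (e 0 l) (bar A (e 0 i) (m 0 i) \<otimes>\<^bsub>A\<^esub> m i l) =
          m 0 i \<otimes>\<^bsub>A\<^esub> bar A (e i l) (m i l)"
        by (simp add: bar_bar_mult closed)
    qed (use l in \<open>auto intro!: A.m_closed bar_closed closed\<close>)
    finally show ?thesis
      unfolding T_def using l
      by (simp, subst A.finsum_ldistr) (auto intro!: A.m_closed bar_closed closed)
  qed
  have right: "m 0 l \<otimes>\<^bsub>A\<^esub> diff A (m l p) = (\<Oplus>\<^bsub>A\<^esub>j\<in>{l<..<p}. T l j)"
    if l: "l \<in> {0<..<p}" for l
  proof -
    have "m 0 l \<otimes>\<^bsub>A\<^esub> diff A (m l p) =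
        (\<Oplus>\<^bsub>A\<^esub>j\<in>{l<..<p}. m 0 l \<otimes>\<^bsub>A\<^esub> (bar A (e l j) (m l j) \<otimes>\<^bsub>A\<^esub> m j p))"
      using l by (subst d, simp_all, subst A.finsum_rdistr)
        (auto intro!: A.m_closed bar_closed closed)
    also have "\<dots> = (\<Oplus>\<^bsub>A\<^esub>j\<in>{l<..<p}. T l j)"
      by (rule M.finsum_cong', rule refl) (use l in \<open>auto simp: T_def closed A.m_assoc\<close>)
    finally show ?thesis .
  qed
  have "diff A (\<Oplus>\<^bsub>A\<^esub>l\<in>{0<..<p}. bar A (e 0 l) (m 0 l) \<otimes>\<^bsub>A\<^esub> m l p) =
      (\<Oplus>\<^bsub>A\<^esub>l\<in>{0<..<p}. diff A (bar A (e 0 l) (m 0 l) \<otimes>\<^bsub>A\<^esub> m l p))"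
    by (rule abelian_group_hom.hom_finsum[OF diff_hom])
      (auto intro!: A.m_closed bar_closed closed)
  also have "\<dots> = (\<Oplus>\<^bsub>A\<^esub>l\<in>{0<..<p}. (\<Oplus>\<^bsub>A\<^esub>i\<in>{0<..<l}. T i l) \<ominus>\<^bsub>A\<^esub> (\<Oplus>\<^bsub>A\<^esub>j\<in>{l<..<p}. T l j))"
    by (rule M.finsum_cong', rule refl)
      (auto simp: leibniz_bar[OF deg deg] left right intro!: M.minus_closed M.finsum_closed)
  also have "\<dots> = (\<Oplus>\<^bsub>A\<^esub>l\<in>{0<..<p}. \<Oplus>\<^bsub>A\<^esub>i\<in>{0<..<l}. T i l) \<ominus>\<^bsub>A\<^esub>
      (\<Oplus>\<^bsub>A\<^esub>l\<in>{0<..<p}. \<Oplus>\<^bsub>A\<^esub>j\<in>{l<..<p}. T l j)"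
    by (rule M.finsum_diff) (auto intro!: M.finsum_closed)
  also have "(\<Oplus>\<^bsub>A\<^esub>l\<in>{0<..<p}. \<Oplus>\<^bsub>A\<^esub>i\<in>{0<..<l}. T i l) =
      (\<Oplus>\<^bsub>A\<^esub>l\<in>{0<..<p}. \<Oplus>\<^bsub>A\<^esub>j\<in>{l<..<p}. T l j)"
    by (rule M.finsum_triangle_swap) auto
  finally show ?thesis
    by (subst (asm) M.minus_eq, subst (asm) M.r_neg) (auto intro!: M.finsum_closed)
qed

end

section \<open>Massey sums over tuples of classes\<close>

text \<open>The differential that a trivial Massey operation is required to have at \<open>hs\<close>; it is zero for
  tuples of length one.\<close>

definition massey_sum :: "('r, 'a) dga \<Rightarrow> ('a set list \<Rightarrow> 'a) \<Rightarrow> 'a set list \<Rightarrow> 'a"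
  where "massey_sum A \<mu> hs = (\<Oplus>\<^bsub>A\<^esub>j\<in>{1..<length hs}.
    bar A (massey_degree A (take j hs)) (\<mu> (take j hs)) \<otimes>\<^bsub>A\<^esub> \<mu> (drop j hs))"

lemma massey_degree_append:
  assumes "xs \<noteq> []" "ys \<noteq> []"
  shows "massey_degree A (xs @ ys) = Suc (massey_degree A xs + massey_degree A ys)"
  using assms by (cases xs; cases ys) (auto simp: massey_degree_def)

lemma massey_degree_take_drop:
  assumes "0 < j" "j < length hs"
  shows "massey_degree A hs = Suc (massey_degree A (take j hs) + massey_degree A (drop j hs))"
  using massey_degree_append[of "take j hs" "drop j hs" A] assms by (cases hs) auto

context dg_algebra
begin

text \<open>Only values on proper nonempty sublists enter a Massey sum; this is what makes the recursion on
  length well founded.\<close>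

lemma massey_sum_cong:
  assumes closed: "\<And>xs. xs \<noteq> [] \<Longrightarrow> set xs \<subseteq> set hs \<Longrightarrow> length xs < length hs \<Longrightarrow> \<mu> xs \<in> carrier A"
    and eq: "\<And>xs. length xs < length hs \<Longrightarrow> \<mu> xs = \<nu> xs"
  shows "massey_sum A \<mu> hs = massey_sum A \<nu> hs"
  unfolding massey_sum_def
proof (rule M.finsum_cong2, rule refl)
  fix j assume j: "j \<in> {1..<length hs}"
  then have "length (take j hs) < length hs" "length (drop j hs) < length hs" by auto
  then show "bar A (massey_degree A (take j hs)) (\<mu> (take j hs)) \<otimes>\<^bsub>A\<^esub> \<mu> (drop j hs) =
    bar A (massey_degree A (take j hs)) (\<nu> (take j hs)) \<otimes>\<^bsub>A\<^esub> \<nu> (drop j hs)"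
    by (simp only: eq)
qed (auto intro!: A.m_closed bar_closed closed dest: in_set_takeD in_set_dropD)

lemma massey_sum_hpart:
  assumes "\<And>xs. xs \<noteq> [] \<Longrightarrow> set xs \<subseteq> set hs \<Longrightarrow> length xs < length hs \<Longrightarrow>
    \<mu> xs \<in> hpart A (massey_degree A xs)"
  shows "massey_sum A \<mu> hs \<in> hpart A (massey_degree A hs - 1)"
  unfolding massey_sum_def
proof (rule hpart_finsum)
  fix j assume j: "j \<in> {1..<length hs}"
  have "bar A (massey_degree A (take j hs)) (\<mu> (take j hs)) \<otimes>\<^bsub>A\<^esub> \<mu> (drop j hs)
      \<in> hpart A (massey_degree A (take j hs) + massey_degree A (drop j hs))"
    using j by (intro mult_hpart bar_hpart assms) (auto dest: in_set_takeD in_set_dropD)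
  then show "bar A (massey_degree A (take j hs)) (\<mu> (take j hs)) \<otimes>\<^bsub>A\<^esub> \<mu> (drop j hs)
      \<in> hpart A (massey_degree A hs - 1)"
    using j massey_degree_take_drop[of j hs A] by simp
qed

lemma diff_massey_sum:
  assumes deg: "\<And>xs. xs \<noteq> [] \<Longrightarrow> set xs \<subseteq> set hs \<Longrightarrow> length xs < length hs \<Longrightarrow>
      \<mu> xs \<in> hpart A (massey_degree A xs)"
    and d: "\<And>xs. xs \<noteq> [] \<Longrightarrow> set xs \<subseteq> set hs \<Longrightarrow> length xs < length hs \<Longrightarrow>
      diff A (\<mu> xs) = massey_sum A \<mu> xs"
  shows "diff A (massey_sum A \<mu> hs) = \<zero>\<^bsub>A\<^esub>"
proof -
  \<comment> \<open>The slice of \<open>hs\<close> between two cut points; prefixes and suffixes of slices are slices.\<close>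
  define s where "s = (\<lambda>i j. take (j - i) (drop i hs))"
  let ?p = "length hs"
  have s: "s i j \<noteq> []" "set (s i j) \<subseteq> set hs" if "i < j" "j \<le> ?p" for i j
    using that by (auto simp: s_def dest: in_set_takeD in_set_dropD)
  have short: "length (s i j) < ?p" if "i < j" "j \<le> ?p" "(i, j) \<noteq> (0, ?p)" for i j
    using that by (auto simp: s_def)
  have take_s: "take (l - i) (s i j) = s i l" and drop_s: "drop (l - i) (s i j) = s l j"
    if "i < l" "l < j" for i l j
    using that by (simp_all add: s_def min_def drop_take)
  have "diff A (\<Oplus>\<^bsub>A\<^esub>l\<in>{0<..<?p}. bar A (massey_degree A (s 0 l)) (\<mu> (s 0 l)) \<otimes>\<^bsub>A\<^esub> \<mu> (s l ?p))
      = \<zero>\<^bsub>A\<^esub>"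
  proof (rule massey_sum_cycle[where m = "\<lambda>i j. \<mu> (s i j)" and e = "\<lambda>i j. massey_degree A (s i j)"])
    fix i j assume ij: "i < j" "j \<le> ?p" "(i, j) \<noteq> (0, ?p)"
    show "\<mu> (s i j) \<in> hpart A (massey_degree A (s i j))"
      using ij s short by (intro deg) auto
    have len: "length (s i j) = j - i" using ij by (simp add: s_def)
    have img: "{i<..<j} = (\<lambda>l. l + i) ` {1..<j - i}"
    proof (intro equalityI subsetI)
      fix l assume "l \<in> {i<..<j}"
      then show "l \<in> (\<lambda>l. l + i) ` {1..<j - i}" by (intro image_eqI[of _ _ "l - i"]) auto
    qed auto
    have closed [simp]: "\<mu> (s i l) \<in> carrier A" "\<mu> (s l j) \<in> carrier A" if "i < l" "l < j" for l
      using that ij s[of i l] s[of l j] short[of i l] short[of l j]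
      by (auto intro!: hpart_carrier[OF deg])
    have "diff A (\<mu> (s i j)) = massey_sum A \<mu> (s i j)"
      using ij s short by (intro d) auto
    also have "\<dots> = (\<Oplus>\<^bsub>A\<^esub>l\<in>{1..<j - i}.
        bar A (massey_degree A (s i (l + i))) (\<mu> (s i (l + i))) \<otimes>\<^bsub>A\<^esub> \<mu> (s (l + i) j))"
      unfolding massey_sum_def len
    proof (rule M.finsum_cong', rule refl)
      fix l assume "l \<in> {1..<j - i}"
      then have "l + i < j" "0 < l" by auto
      then show "bar A (massey_degree A (take l (s i j))) (\<mu> (take l (s i j))) \<otimes>\<^bsub>A\<^esub> \<mu> (drop l (s i j))
        = bar A (massey_degree A (s i (l + i))) (\<mu> (s i (l + i))) \<otimes>\<^bsub>A\<^esub> \<mu> (s (l + i) j)"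
        using take_s[of i "l + i" j] drop_s[of i "l + i" j] by simp
    qed auto
    also have "\<dots> = (\<Oplus>\<^bsub>A\<^esub>l\<in>{i<..<j}. bar A (massey_degree A (s i l)) (\<mu> (s i l)) \<otimes>\<^bsub>A\<^esub> \<mu> (s l j))"
      unfolding img
      by (rule M.finsum_reindex[symmetric]) auto
    finally show "diff A (\<mu> (s i j)) =
      (\<Oplus>\<^bsub>A\<^esub>l\<in>{i<..<j}. bar A (massey_degree A (s i l)) (\<mu> (s i l)) \<otimes>\<^bsub>A\<^esub> \<mu> (s l j))" .
  next
    fix i l j assume ilj: "i < l" "l < j" "j \<le> ?p"
    then have "l - i < length (s i j)" by (simp add: s_def)
    with ilj show "massey_degree A (s i j) = Suc (massey_degree A (s i l) + massey_degree A (s l j))"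
      using massey_degree_take_drop[of "l - i" "s i j" A] by (simp add: take_s drop_s)
  qed
  moreover have "{0<..<?p} = {1..<?p}" by auto
  ultimately show ?thesis by (simp add: massey_sum_def s_def)
qed

end

section \<open>Homology classes\<close>

context dg_algebra
begin

lemma boundary_closed: "b \<in> boundaries A \<Longrightarrow> b \<in> carrier A"
  by (auto simp: boundaries_def)

lemma boundaries_subgroup: "additive_subgroup (boundaries A) A"
proof -
  have "group_hom (add_monoid A) (add_monoid A) (diff A)"
    using diff_hom by (simp add: abelian_group_hom_def abelian_group_hom_axioms_def)
  from group_hom.img_is_subgroup[OF this] show ?thesis
    unfolding boundaries_def by (simp add: additive_subgroup.intro)
qed

lemma cycle_closed: "z \<in> cycles A \<Longrightarrow> z \<in> carrier A"
  by (simp add: cycles_def)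

lemma carrier_homology: "carrier (homology A) = hclass A ` cycles A"
  by (auto simp: homology_def FactRing_def A_RCOSETS_def' hclass_def a_r_coset_def')

lemma in_hclassE:
  assumes "w \<in> hclass A z"
  obtains b where "b \<in> boundaries A" "w = b \<oplus>\<^bsub>A\<^esub> z"
  using assms by (auto simp: hclass_def a_r_coset_def')

lemma in_hclass_self: "z \<in> carrier A \<Longrightarrow> z \<in> hclass A z"
  unfolding hclass_def a_r_coset_def'
  using additive_subgroup.zero_closed[OF boundaries_subgroup] by force

lemma hclass_eq_iff:
  assumes z: "z \<in> carrier A" and w: "w \<in> carrier A"
  shows "hclass A z = hclass A w \<longleftrightarrow> z \<ominus>\<^bsub>A\<^esub> w \<in> boundaries A"
proof
  assume "hclass A z = hclass A w"
  then obtain b where "b \<in> boundaries A" "z = b \<oplus>\<^bsub>A\<^esub> w"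
    using in_hclass_self[OF z] in_hclassE by metis
  moreover from this have "z \<ominus>\<^bsub>A\<^esub> w = b"
    using w by (simp add: boundary_closed M.minus_eq M.a_assoc M.r_neg)
  ultimately show "z \<ominus>\<^bsub>A\<^esub> w \<in> boundaries A" by simp
next
  assume "z \<ominus>\<^bsub>A\<^esub> w \<in> boundaries A"
  moreover have "z = (z \<ominus>\<^bsub>A\<^esub> w) \<oplus>\<^bsub>A\<^esub> w"
    using z w by (simp add: M.minus_eq M.a_assoc M.l_neg)
  ultimately have "z \<in> hclass A w"
    unfolding hclass_def a_r_coset_def' by blast
  then show "hclass A z = hclass A w"
    unfolding hclass_def
    using M.a_repr_independence[OF _ w] additive_subgroup.a_subgroup[OF boundaries_subgroup] by metis
qed

end

section \<open>Morphisms that are onto on cycles and one-to-one on homology\<close>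

locale dga_morphism = A: dg_algebra R A + B: dg_algebra S B
  for R :: "('r, 'n) ring_scheme" and A :: "('r, 'a) dga"
    and S :: "('s, 'l) ring_scheme" and B :: "('s, 'b) dga" +
  fixes \<phi> :: "'a \<Rightarrow> 'b"
  assumes dga_hom: "\<phi> \<in> dga_hom A B"
begin

lemma ring_hom: "\<phi> \<in> ring_hom A B"
  and map_hpart: "x \<in> hpart A i \<Longrightarrow> \<phi> x \<in> hpart B i"
  and map_diff: "x \<in> carrier A \<Longrightarrow> \<phi> (diff A x) = diff B (\<phi> x)"
  using dga_hom by (auto simp: dga_hom_def)

lemma map_closed [simp]: "x \<in> carrier A \<Longrightarrow> \<phi> x \<in> carrier B"
  and map_mult: "x \<in> carrier A \<Longrightarrow> y \<in> carrier A \<Longrightarrow> \<phi> (x \<otimes>\<^bsub>A\<^esub> y) = \<phi> x \<otimes>\<^bsub>B\<^esub> \<phi> y"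
  and map_add: "x \<in> carrier A \<Longrightarrow> y \<in> carrier A \<Longrightarrow> \<phi> (x \<oplus>\<^bsub>A\<^esub> y) = \<phi> x \<oplus>\<^bsub>B\<^esub> \<phi> y"
  using ring_hom by (auto simp: ring_hom_def)

sublocale hom: abelian_group_hom A B \<phi>
  by (intro abelian_group_homI A.M.abelian_group_axioms B.M.abelian_group_axioms)
    (auto simp: group_hom_def group_hom_axioms_def hom_def A.M.add.is_group B.M.add.is_group map_add)

lemma map_minus: "x \<in> carrier A \<Longrightarrow> y \<in> carrier A \<Longrightarrow> \<phi> (x \<ominus>\<^bsub>A\<^esub> y) = \<phi> x \<ominus>\<^bsub>B\<^esub> \<phi> y"
  by (simp add: A.M.minus_eq B.M.minus_eq)

lemma map_bar: "x \<in> carrier A \<Longrightarrow> \<phi> (bar A i x) = bar B i (\<phi> x)"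
  by (simp add: A.bar_eq B.bar_eq)

lemma map_boundary: "b \<in> boundaries A \<Longrightarrow> \<phi> b \<in> boundaries B"
  by (auto simp: boundaries_def map_diff)

lemma map_cycle: "z \<in> cycles A \<Longrightarrow> \<phi> z \<in> cycles B"
  by (auto simp: cycles_def map_diff[symmetric])

lemma homology_map_hclass:
  assumes z: "z \<in> cycles A"
  shows "homology_map A B \<phi> (hclass A z) = hclass B (\<phi> z)"
proof -
  note zc = A.cycle_closed[OF z]
  have "hclass B (\<phi> w) = hclass B (\<phi> z)" if w: "w \<in> hclass A z" for w
  proof -
    obtain b where b: "b \<in> boundaries A" "w = b \<oplus>\<^bsub>A\<^esub> z" using A.in_hclassE[OF w] by metis
    then have "\<phi> w \<ominus>\<^bsub>B\<^esub> \<phi> z = \<phi> b"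
      using zc by (simp add: A.boundary_closed B.M.minus_eq B.M.a_assoc B.M.r_neg)
    with b show ?thesis
      using zc by (subst B.hclass_eq_iff) (auto simp: A.boundary_closed map_boundary)
  qed
  then show ?thesis
    unfolding homology_map_def using A.in_hclass_self[OF zc] by blast
qed

end

locale cycle_lifting_morphism = dga_morphism R A S B \<phi>
  for R :: "('r, 'n) ring_scheme" and A :: "('r, 'a) dga"
    and S :: "('s, 'l) ring_scheme" and B :: "('s, 'b) dga" and \<phi> :: "'a \<Rightarrow> 'b" +
  assumes cycles_onto: "\<phi> ` cycles A = cycles B"
    and homology_inj: "inj_on (homology_map A B \<phi>) (carrier (homology A))"
begin

text \<open>The component of degree \<open>n\<close> of an arbitrary preimage is still a cycle and still maps to \<open>w\<close>.\<close>

lemma lift_cycle: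
  assumes "w \<in> cycles B" "w \<in> hpart B n"
  obtains z where "z \<in> cycles A" "z \<in> hpart A n" "\<phi> z = w"
proof -
  obtain z where z: "z \<in> cycles A" "\<phi> z = w" using cycles_onto assms(1) by (metis imageE)
  obtain f N where f: "\<And>i. f i \<in> hpart A i" "z = (\<Oplus>\<^bsub>A\<^esub>i\<in>{..N}. f i)" "n \<le> N"
    using A.homogeneous_decomposition[OF A.cycle_closed[OF z(1)]] by metis
  have "diff A (f n) = \<zero>\<^bsub>A\<^esub>"
    using z f by (intro A.component_of_cycle[of f N n]) (auto simp: cycles_def)
  moreover have w: "w = (\<Oplus>\<^bsub>B\<^esub>i\<in>{..N}. \<phi> (f i))"
    unfolding z(2)[symmetric] f(2) by (rule hom.hom_finsum) (use f A.hpart_carrier in auto)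
  have "\<phi> (f n) = w"
    using f assms by (subst w, intro B.component_of_homogeneous_sum) (auto simp: map_hpart w)
  ultimately show thesis
    using that f(1) A.hpart_carrier by (auto simp: cycles_def)
qed

lemma hclass_eqI:
  assumes "z \<in> cycles A" "w \<in> cycles A" "hclass B (\<phi> z) = hclass B (\<phi> w)"
  shows "hclass A z = hclass A w"
  using assms by (intro inj_onD[OF homology_inj]) (auto simp: A.carrier_homology homology_map_hclass)

lemma reflect_boundary:
  assumes z: "z \<in> cycles A" and b: "\<phi> z \<in> boundaries B"
  shows "z \<in> boundaries A"
proof -
  have zero: "\<zero>\<^bsub>A\<^esub> \<in> cycles A"
    using abelian_group_hom.hom_zero[OF A.diff_hom] by (simp add: cycles_def)
  have "hclass A z = hclass A \<zero>\<^bsub>A\<^esub>"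
    using z zero b A.cycle_closed
    by (intro hclass_eqI) (auto simp: B.hclass_eq_iff B.M.minus_eq)
  then show ?thesis
    using z A.cycle_closed by (auto simp: A.hclass_eq_iff A.M.minus_eq)
qed

text \<open>An arbitrary primitive \<open>a\<close> of \<open>w\<close> maps to a primitive of \<open>\<phi> w\<close>, which differs from \<open>b\<close> by a
  cycle; subtracting a lift of that cycle corrects \<open>a\<close> without changing its differential.\<close>

lemma lift_primitive:
  assumes w: "w \<in> cycles A" "w \<in> hpart A n" and b: "b \<in> hpart B (Suc n)" "diff B b = \<phi> w"
  obtains a where "a \<in> hpart A (Suc n)" "diff A a = w" "\<phi> a = b"
proof -
  note bc = B.hpart_carrier[OF b(1)]
  have "\<phi> w \<in> boundaries B" using b(2) bc by (auto simp: boundaries_def intro!: image_eqI[of _ _ b])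
  then have "w \<in> boundaries A" by (rule reflect_boundary[OF w(1)])
  then obtain a' where "a' \<in> carrier A" "diff A a' = w" by (auto simp: boundaries_def)
  with w(2) obtain a where a: "a \<in> hpart A (Suc n)" "diff A a = w"
    using A.homogeneous_boundary[of a' n] by metis
  note ac = A.hpart_carrier[OF a(1)]
  have "\<phi> a \<ominus>\<^bsub>B\<^esub> b \<in> cycles B"
    using ac bc a b w abelian_group_hom.hom_a_inv[OF B.diff_hom] abelian_group_hom.hom_add[OF B.diff_hom]
    by (auto simp: cycles_def B.M.minus_eq map_diff[symmetric] B.M.r_neg)
  then obtain c where c: "c \<in> cycles A" "c \<in> hpart A (Suc n)" "\<phi> c = \<phi> a \<ominus>\<^bsub>B\<^esub> b"
    using lift_cycle a b map_hpart B.hpart_minus by metis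
  note cc = A.hpart_carrier[OF c(2)]
  show thesis
  proof (rule that)
    show "a \<ominus>\<^bsub>A\<^esub> c \<in> hpart A (Suc n)" using a c by (intro A.hpart_minus)
    show "diff A (a \<ominus>\<^bsub>A\<^esub> c) = w"
      using ac cc a c(1) A.cycle_closed[OF w(1)]
        abelian_group_hom.hom_a_inv[OF A.diff_hom] abelian_group_hom.hom_add[OF A.diff_hom]
      by (simp add: cycles_def A.M.minus_eq)
    show "\<phi> (a \<ominus>\<^bsub>A\<^esub> c) = b"
      using ac cc bc c(3)
      by (simp add: map_minus B.M.minus_eq B.M.minus_add B.M.a_assoc[symmetric] B.M.r_neg)
  qed
qed

text \<open>Since \<open>h\<close> and its image lie in the summands of homology of exactly the same degrees, the two
  definite descriptions coincide. This covers \<open>h = 0\<close>, which lies in every summand and for which the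
  degree is an unspecified number.\<close>

lemma hdegree_homology_map:
  assumes h: "h \<in> carrier (homology A)"
  shows "hdegree B (homology_map A B \<phi> h) = hdegree A h"
proof -
  have "homology_map A B \<phi> h \<in> homology_part B i \<longleftrightarrow> h \<in> homology_part A i" for i
  proof
    assume "h \<in> homology_part A i"
    then show "homology_map A B \<phi> h \<in> homology_part B i"
      by (auto simp: homology_part_def homology_map_hclass map_cycle map_hpart)
  next
    assume "homology_map A B \<phi> h \<in> homology_part B i"
    then obtain w where w: "w \<in> cycles B" "w \<in> hpart B i" "homology_map A B \<phi> h = hclass B w"
      by (auto simp: homology_part_def)
    then obtain z where z: "z \<in> cycles A" "z \<in> hpart A i" "\<phi> z = w"
      using lift_cycle by metis
    obtain y where y: "y \<in> cycles A" "h = hclass A y" using h by (auto simp: A.carrier_homology)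
    have "h = hclass A z"
      unfolding y(2) using y z w by (intro hclass_eqI) (auto simp: homology_map_hclass)
    with z show "h \<in> homology_part A i" by (auto simp: homology_part_def)
  qed
  then show ?thesis by (simp add: hdegree_def)
qed

lemma massey_degree_homology_map:
  assumes "set hs \<subseteq> carrier (homology A)"
  shows "massey_degree B (map (homology_map A B \<phi>) hs) = massey_degree A hs"
proof -
  have "map (hdegree B \<circ> homology_map A B \<phi>) hs = map (hdegree A) hs"
    using assms by (auto simp: hdegree_homology_map)
  then show ?thesis by (simp add: massey_degree_def del: map_eq_conv)
qed

lemma map_massey_sum:
  assumes hs: "set hs \<subseteq> carrier (homology A)"
    and closed: "\<And>xs. xs \<noteq> [] \<Longrightarrow> set xs \<subseteq> set hs \<Longrightarrow> length xs < length hs \<Longrightarrow> \<mu>' xs \<in> carrier A"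
    and map: "\<And>xs. xs \<noteq> [] \<Longrightarrow> set xs \<subseteq> set hs \<Longrightarrow> length xs < length hs \<Longrightarrow>
      \<phi> (\<mu>' xs) = \<mu> (map (homology_map A B \<phi>) xs)"
  shows "\<phi> (massey_sum A \<mu>' hs) = massey_sum B \<mu> (map (homology_map A B \<phi>) hs)"
proof -
  have sub: "take j hs \<noteq> []" "set (take j hs) \<subseteq> set hs" "length (take j hs) < length hs"
    "drop j hs \<noteq> []" "set (drop j hs) \<subseteq> set hs" "length (drop j hs) < length hs"
    if "j \<in> {1..<length hs}" for j
    using that by (auto dest: in_set_takeD in_set_dropD)
  have c: "\<mu>' (take j hs) \<in> carrier A" "\<mu>' (drop j hs) \<in> carrier A"
    if "j \<in> {1..<length hs}" for j
    using sub[OF that] by (auto intro!: closed)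
  have deg: "massey_degree B (map (homology_map A B \<phi>) (take j hs)) = massey_degree A (take j hs)" for j
    using hs set_take_subset[of j hs] by (intro massey_degree_homology_map) auto
  have "\<phi> (massey_sum A \<mu>' hs) = (\<Oplus>\<^bsub>B\<^esub>j\<in>{1..<length hs}.
      \<phi> (bar A (massey_degree A (take j hs)) (\<mu>' (take j hs)) \<otimes>\<^bsub>A\<^esub> \<mu>' (drop j hs)))"
    unfolding massey_sum_def by (rule hom.hom_finsum) (use c in auto)
  also have "\<dots> = massey_sum B \<mu> (map (homology_map A B \<phi>) hs)"
    unfolding massey_sum_def length_map
  proof (rule B.M.finsum_cong2, rule refl)
    fix j assume j: "j \<in> {1..<length hs}"
    show "\<phi> (bar A (massey_degree A (take j hs)) (\<mu>' (take j hs)) \<otimes>\<^bsub>A\<^esub> \<mu>' (drop j hs)) =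
      bar B (massey_degree B (take j (map (homology_map A B \<phi>) hs))) (\<mu> (take j (map (homology_map A B \<phi>) hs)))
        \<otimes>\<^bsub>B\<^esub> \<mu> (drop j (map (homology_map A B \<phi>) hs))"
      using c[OF j] sub[OF j]
      by (simp add: map_mult map_bar map take_map drop_map deg)
  qed (use c in auto)
  finally show ?thesis .
qed


text \<open>The value at a tuple is a choice that depends on the choices made at shorter tuples, so the
  operation comes from dependent choice along the length. The inductive step is \<open>lift_cycle\<close> for tuples
  of length one and \<open>lift_primitive\<close> for longer ones.\<close>

theorem lift_trivial_massey_operation:
  assumes \<B>\<^sub>A: "\<B>\<^sub>A \<subseteq> carrier (homology A)"
    and \<B>\<^sub>B: "homology_map A B \<phi> ` \<B>\<^sub>A \<subseteq> \<B>\<^sub>B"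
    and \<mu>: "trivial_massey_operation B \<B>\<^sub>B \<mu>"
  shows "\<exists>\<mu>'. trivial_massey_operation A \<B>\<^sub>A \<mu>' \<and>
    (\<forall>hs\<in>lists \<B>\<^sub>A. hs \<noteq> [] \<longrightarrow> \<phi> (\<mu>' hs) = \<mu> (map (homology_map A B \<phi>) hs))"
proof -
  let ?\<Phi> = "homology_map A B \<phi>"
  \<comment> \<open>\<open>P f hs x\<close> says that \<open>x\<close> is a suitable value at \<open>hs\<close> when \<open>f\<close> gives the values at shorter
    tuples. Cutting \<open>f\<close> off makes it evident that \<open>P\<close> looks at nothing but these values.\<close>
  let ?cut = "\<lambda>f hs xs. if length xs < length hs then f xs else undefined"
  define P where "P = (\<lambda>f hs x. hs \<in> lists \<B>\<^sub>A \<longrightarrow> hs \<noteq> [] \<longrightarrow>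
    x \<in> hpart A (massey_degree A hs) \<and> \<phi> x = \<mu> (map ?\<Phi> hs) \<and>
    diff A x = massey_sum A (?cut f hs) hs \<and> (\<forall>h. hs = [h] \<longrightarrow> hclass A x = h))"
  have "\<exists>\<mu>'. \<forall>hs. P \<mu>' hs (\<mu>' hs)"
  proof (rule dependent_wf_choice[OF wf_measure[of length]])
    fix f g :: "'a set list \<Rightarrow> 'a" and hs x
    assume "\<And>xs. (xs, hs) \<in> measure length \<Longrightarrow> f xs = g xs"
    then have "?cut f hs = ?cut g hs" by auto
    then show "P f hs x = P g hs x" by (simp only: P_def)
  next
    fix hs f assume IH: "\<And>xs. (xs, hs) \<in> measure length \<Longrightarrow> P f xs (f xs)"
    show "\<exists>x. P f hs x"
    proof (cases "hs \<in> lists \<B>\<^sub>A \<and> hs \<noteq> []")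
      case False
      then show ?thesis by (auto simp: P_def)
    next
      case True
      then have hs: "set hs \<subseteq> carrier (homology A)" and hs_B: "map ?\<Phi> hs \<in> lists \<B>\<^sub>B"
        using \<B>\<^sub>A \<B>\<^sub>B by (auto simp: image_subset_iff)
      let ?b = "\<mu> (map ?\<Phi> hs)"
      have "map ?\<Phi> hs \<noteq> []" using True by simp
      with \<mu> hs_B have "?b \<in> hpart B (massey_degree B (map ?\<Phi> hs))"
        and diff_b: "diff B ?b = massey_sum B \<mu> (map ?\<Phi> hs)"
        unfolding trivial_massey_operation_def massey_sum_def by blast+
      then have b: "?b \<in> hpart B (massey_degree A hs)"
        by (simp only: massey_degree_homology_map[OF hs])
      show ?thesis
      proof (cases "length hs = 1")
        case singleton: True
        then obtain h where h: "hs = [h]" by (auto simp: length_Suc_conv)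
        then have "?\<Phi> h \<in> \<B>\<^sub>B" using True \<B>\<^sub>B by auto
        then have cycle: "?b \<in> cycles B" "hclass B ?b = ?\<Phi> h"
          using \<mu> by (auto simp: h trivial_massey_operation_def)
        obtain z where z: "z \<in> cycles A" "z \<in> hpart A (massey_degree A hs)" "\<phi> z = ?b"
          using lift_cycle[OF cycle(1) b] by metis
        obtain y where y: "y \<in> cycles A" "h = hclass A y"
          using hs by (auto simp: h A.carrier_homology)
        have "hclass A z = h"
          unfolding y(2) using z y cycle(2) by (intro hclass_eqI) (auto simp: homology_map_hclass)
        moreover have "diff A z = \<zero>\<^bsub>A\<^esub>" using z by (simp add: cycles_def)
        ultimately have "P f hs z" using z by (simp add: P_def h massey_sum_def)
        then show ?thesis ..
      next
        case False
        with True have len: "1 < length hs" by (cases hs) auto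
        let ?f = "?cut f hs"
        have f: "?f xs \<in> hpart A (massey_degree A xs)" "\<phi> (?f xs) = \<mu> (map ?\<Phi> xs)"
          and d: "diff A (?f xs) = massey_sum A (?cut f xs) xs"
          if "xs \<noteq> []" "set xs \<subseteq> set hs" "length xs < length hs" for xs
          using IH[of xs] that True by (auto simp: P_def)
        have d: "diff A (?f xs) = massey_sum A ?f xs"
          if "xs \<noteq> []" "set xs \<subseteq> set hs" "length xs < length hs" for xs
          unfolding d[OF that]
        proof (rule A.massey_sum_cong)
          fix ys assume ys: "ys \<noteq> []" "set ys \<subseteq> set xs" "length ys < length xs"
          then have "?f ys \<in> carrier A"
            using that by (intro A.hpart_carrier[OF f(1)]) auto
          then show "?cut f xs ys \<in> carrier A" using ys that by simp
        qed (use that in simp)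
        have w: "massey_sum A ?f hs \<in> hpart A (massey_degree A hs - 1)"
          using f(1) by (rule A.massey_sum_hpart)
        have "diff A (massey_sum A ?f hs) = \<zero>\<^bsub>A\<^esub>"
          using f(1) d by (rule A.diff_massey_sum)
        then have cycle: "massey_sum A ?f hs \<in> cycles A"
          using A.hpart_carrier[OF w] by (simp add: cycles_def)
        have over: "diff B ?b = \<phi> (massey_sum A ?f hs)"
          unfolding diff_b using f A.hpart_carrier
          by (intro map_massey_sum[symmetric] hs) blast+
        have deg: "Suc (massey_degree A hs - 1) = massey_degree A hs"
          using len by (simp add: massey_degree_def)
        obtain x where "x \<in> hpart A (massey_degree A hs)"
          "diff A x = massey_sum A ?f hs" "\<phi> x = ?b"
          by (rule lift_primitive[OF cycle w, unfolded deg, OF b over])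
        then have "P f hs x" using len by (auto simp: P_def)
        then show ?thesis ..
      qed
    qed
  qed
  then obtain \<mu>' where \<mu>': "P \<mu>' hs (\<mu>' hs)" for hs by blast
  have closed: "\<mu>' hs \<in> carrier A" if "hs \<in> lists \<B>\<^sub>A" "hs \<noteq> []" for hs
    using \<mu>'[of hs] that A.hpart_carrier by (auto simp: P_def)
  have d: "diff A (\<mu>' hs) = massey_sum A \<mu>' hs" if "hs \<in> lists \<B>\<^sub>A" "hs \<noteq> []" for hs
  proof -
    have "massey_sum A (?cut \<mu>' hs) hs = massey_sum A \<mu>' hs"
      using that closed by (intro A.massey_sum_cong) auto
    with \<mu>'[of hs] that show ?thesis by (simp add: P_def)
  qed
  have "trivial_massey_operation A \<B>\<^sub>A \<mu>'"
    unfolding trivial_massey_operation_def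
  proof (intro conjI ballI impI)
    fix h assume h: "h \<in> \<B>\<^sub>A"
    show "\<mu>' [h] \<in> cycles A"
      using closed[of "[h]"] d[of "[h]"] h by (simp add: cycles_def massey_sum_def)
    show "hclass A (\<mu>' [h]) = h"
      using \<mu>'[of "[h]"] h by (simp add: P_def)
  qed (use \<mu>' d in \<open>auto simp: P_def massey_sum_def\<close>)
  with \<mu>' show ?thesis by (auto simp: P_def)
qed

end

theorem theorem2p9:
  fixes K :: "('k, 'm) ring_scheme"
    and R :: "('r, 'n) ring_scheme" and S :: "('s, 'l) ring_scheme"
    and A :: "('r, 'a) dga" and B :: "('s, 'b) dga"
    and \<iota>\<^sub>A :: "'k \<Rightarrow> 'a set" and \<iota>\<^sub>B :: "'k \<Rightarrow> 'b set"
    and \<phi> :: "'a \<Rightarrow> 'b"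
    and \<B>\<^sub>A :: "'a set set" and \<B>\<^sub>B :: "'b set set"
    and \<mu> :: "'b set list \<Rightarrow> 'b"
  assumes "field K"
    and "dg_algebra R A" and "dg_algebra S B"
    and "\<iota>\<^sub>A \<in> ring_iso K (homology_0 A)" and "\<iota>\<^sub>B \<in> ring_iso K (homology_0 B)"
    and "\<phi> \<in> dga_hom A B"
    and "homology_map A B \<phi> \<in> module_hom K (homology_space \<iota>\<^sub>A A) (homology_space \<iota>\<^sub>B B)"
    and "\<phi> ` cycles A = cycles B"
    and "inj_on (homology_map A B \<phi>) (carrier (homology A))"
    and "homogeneous_basis K \<iota>\<^sub>A A \<B>\<^sub>A" and "homogeneous_basis K \<iota>\<^sub>B B \<B>\<^sub>B"
    and "homology_map A B \<phi> ` \<B>\<^sub>A \<subseteq> \<B>\<^sub>B"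
    and "trivial_massey_operation B \<B>\<^sub>B \<mu>"
  shows "\<exists>\<mu>'. trivial_massey_operation A \<B>\<^sub>A \<mu>' \<and>
    (\<forall>hs\<in>lists \<B>\<^sub>A. hs \<noteq> [] \<longrightarrow> \<phi> (\<mu>' hs) = \<mu> (map (homology_map A B \<phi>) hs))"
proof -
  interpret cycle_lifting_morphism R A S B \<phi>
    using assms by (simp add: cycle_lifting_morphism_def cycle_lifting_morphism_axioms_def
      dga_morphism_def dga_morphism_axioms_def)
  have "\<B>\<^sub>A \<subseteq> carrier (homology A)"
    using assms(10) by (auto simp: homogeneous_basis_def homology_part_def A.carrier_homology)
  with assms(12,13) show ?thesis by (intro lift_trivial_massey_operation)
qed

end
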